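(* Let $0<\alpha<1/2$, let $n\ge 2$, and let $S$ be a set of $n$ points in $\mathbb{R}^2$ such that no line contains more than $n^{\alpha}$ points of $S$. Then the number of unordered pairs $\{p,q\}\subset S$ such that $|p-q|\in\mathbb{Q}$ and $\{p,q\}$ has rational angle is at most $n^{1+\alpha+6/\sqrt{\log n}}$, where $\log$ denotes the natural logarithm.
   Context: Identify $\mathbb{R}^2$ with $\mathbb{C}$. A pair of distinct points $p,q$ has rational angle if the segment between them, viewed as the complex number $q-p=re^{\pi i\gamma}$ with $r>0$, has $\gamma\in\mathbb{Q}$; equivalently, the line through $p$ and $q$ makes an angle with the $x$-axis that is a rational multiple of $\pi$. *)

theory Defs
  imports "HOL-Analysis.Analysis"
begin

definition rational_angle :: "complex \<Rightarrow> complex \<Rightarrow> bool" where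
  "rational_angle p q \<longleftrightarrow> p \<noteq> q \<and>
     (\<exists>r::real. \<exists>\<gamma>::real. r > 0 \<and> \<gamma> \<in> \<rat> \<and> q - p = of_real r * exp (\<i> * of_real (pi * \<gamma>)))"

definition plane_line :: "complex \<Rightarrow> complex \<Rightarrow> complex set" where
  "plane_line a b = {a + of_real t * b | t. True}"

end

theory Submission
  imports Defs "HOL-Computational_Algebra.Computational_Algebra"
begin

text \<open>
  Call a walk irredundant if no nonempty subfamily of its steps sums to zero, and let
  \<open>L = sqrt (ln n)\<close>. If there were too many edges, some subset of \<open>S\<close> would have minimum degree
  above \<open>n powr \<alpha> * exp (6 * L)\<close>; choosing steps greedily then gives many irredundant walks of
  length \<open>k \<approx> L / 2\<close> from a fixed vertex, hence many with the same end point. But the difference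
  of two such walks is a vanishing rational combination of roots of unity, and Mann's theorem,
  applied to its minimal vanishing subsums, shows that every direction in one walk is a direction
  of the other times a root of unity of order dividing the product of the primes up to
  \<open>2 * k\<close>. So only \<open>k * 4 ^ (2 * k)\<close> directions occur, each allows at most \<open>n powr \<alpha>\<close>
  choices of the next vertex, and this is too few.
\<close>

subsection \<open>Conjugates of roots of unity\<close>

definition ieval :: "int poly \<Rightarrow> complex \<Rightarrow> complex" where
  "ieval p z = poly (map_poly of_int p) z"

lemma ieval_0 [simp]: "ieval 0 z = 0"
  by (simp add: ieval_def)

lemma ieval_pCons [simp]: "ieval (pCons a p) z = of_int a + z * ieval p z"
  by (simp add: ieval_def map_poly_pCons)

lemma ieval_1 [simp]: "ieval 1 z = 1"
  unfolding one_pCons by simp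

lemma ieval_add [simp]: "ieval (p + q) z = ieval p z + ieval q z"
  by (induction p q rule: poly_induct2) (simp_all add: algebra_simps)

lemma ieval_smult [simp]: "ieval (smult c p) z = of_int c * ieval p z"
  by (induction p) (simp_all add: algebra_simps)

lemma ieval_minus [simp]: "ieval (- p) z = - ieval p z"
  by (induction p) (simp_all add: algebra_simps)

lemma ieval_diff [simp]: "ieval (p - q) z = ieval p z - ieval q z"
  using ieval_add[of p "- q" z] by simp

lemma ieval_mult [simp]: "ieval (p * q) z = ieval p z * ieval q z"
  by (induction p) (simp_all add: algebra_simps)

lemma ieval_power [simp]: "ieval (p ^ k) z = ieval p z ^ k"
  by (induction k) simp_all

lemma ieval_sum: "ieval (sum f A) z = (\<Sum>i\<in>A. ieval (f i) z)"
  by (induction A rule: infinite_finite_induct) simp_all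

lemma ieval_monom [simp]: "ieval (monom c k) z = of_int c * z ^ k"
  by (induction k) (simp_all add: monom_0 monom_Suc)

lemma ieval_pcompose [simp]: "ieval (pcompose p q) z = ieval p (ieval q z)"
  by (induction p) (simp_all add: pcompose_pCons)

text \<open>All inner binomial coefficients of a prime row are multiples of the prime. A general
  commutative ring is used because the identity is needed both in the integers and in integer
  polynomials.\<close>

lemma prime_dvd_freshman:
  fixes a b :: "'a::comm_ring_1"
  assumes "prime q"
  shows "of_nat q dvd (a + b) ^ q - (a ^ q + b ^ q)"
proof -
  have q: "q > 0" using assms prime_gt_0_nat by blast
  have "(a + b) ^ q = (\<Sum>k\<le>q. of_nat (q choose k) * a ^ k * b ^ (q - k))"
    by (rule binomial_ring)
  also have "{..q} = insert 0 (insert q {0<..<q})" using q by auto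
  finally have "(a + b) ^ q - (a ^ q + b ^ q) =
      (\<Sum>k\<in>{0<..<q}. of_nat (q choose k) * a ^ k * b ^ (q - k))"
    using q by (simp add: algebra_simps)
  also have "of_nat q dvd \<dots>"
  proof (rule dvd_sum)
    fix k assume "k \<in> {0<..<q}"
    then have "q dvd (q choose k)" using assms by (intro dvd_choose_prime) auto
    then have "(of_nat q :: 'a) dvd of_nat (q choose k)" by (metis dvd_def of_nat_mult)
    then show "of_nat q dvd of_nat (q choose k) * a ^ k * b ^ (q - k)"
      by (simp add: mult.assoc)
  qed
  finally show ?thesis .
qed

lemma prime_dvd_power_minus_self:
  fixes a :: int
  assumes "prime q"
  shows "int q dvd a ^ q - a"
proof -
  have q: "q > 0" using assms prime_gt_0_nat by blast
  \<comment> \<open>Stated as an equivalence so that it serves the upward and the downward half of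
    the induction over the integers.\<close>
  have step: "int q dvd (a + 1) ^ q - (a + 1) \<longleftrightarrow> int q dvd a ^ q - a" for a :: int
  proof -
    have "int q dvd (a + 1) ^ q - (a ^ q + 1 ^ q)"
      using prime_dvd_freshman[OF assms, of a 1] by simp
    from dvd_add_right_iff[OF this, of "a ^ q - a"] show ?thesis
      by (simp add: algebra_simps)
  qed
  show ?thesis
  proof (induction a rule: int_induct[where k = 0])
    case base
    then show ?case using q by (simp add: power_0_left)
  next
    case (step1 i)
    then show ?case using step by simp
  next
    case (step2 i)
    then show ?case using step[of "i - 1"] by simp
  qed
qed

text \<open>Induction on the coefficients: \<open>pCons a h\<close> is \<open>a + X * h\<close>, the
  power splits modulo \<open>q\<close>, Fermat's little theorem handles \<open>a\<close>, and
  \<open>X ^ q\<close> is \<open>monom 1 q\<close>.\<close>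

lemma prime_dvd_frobenius:
  fixes h :: "int poly"
  assumes "prime q"
  shows "of_nat q dvd h ^ q - pcompose h (monom 1 q)"
proof (induction h)
  case 0
  then show ?case using assms prime_gt_0_nat by (auto simp: power_0_left)
next
  case (pCons a h)
  have 1: "pCons a h = [:a:] + [:0, 1:] * h" by simp
  have "of_nat q dvd (pCons a h) ^ q - ([:a:] ^ q + ([:0, 1:] * h) ^ q)"
    unfolding 1 by (rule prime_dvd_freshman[OF assms])
  moreover have "of_nat q dvd [:a:] ^ q - [:a:]"
  proof -
    have "[:a:] ^ q = [:a ^ q:]" by (induction q) (simp_all add: one_pCons)
    moreover obtain k where "a ^ q - a = int q * k"
      using prime_dvd_power_minus_self[OF assms] by (auto simp: dvd_def)
    ultimately have "[:a:] ^ q - [:a:] = of_nat q * [:k:]"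
      by (simp add: of_nat_poly)
    then show ?thesis by (metis dvd_triv_left)
  qed
  moreover have "of_nat q dvd monom 1 q * (h ^ q - pcompose h (monom 1 q))"
    using pCons.IH by simp
  moreover have "[:0, 1:] ^ q = (monom 1 q :: int poly)"
    by (metis One_nat_def monom_altdef smult_1_left)
  ultimately have "of_nat q dvd (pCons a h ^ q - ([:a:] ^ q + ([:0, 1:] * h) ^ q))
     + ([:a:] ^ q - [:a:]) + monom 1 q * (h ^ q - pcompose h (monom 1 q))"
    by (intro dvd_add)
  also have "\<dots> = pCons a h ^ q - pcompose (pCons a h) (monom 1 q)"
    unfolding power_mult_distrib \<open>[:0, 1:] ^ q = _\<close>
    by (simp add: pcompose_pCons right_diff_distrib)
  finally show ?case .
qed

text \<open>Gauss's lemma makes the primitive integer polynomial of least degree monic.\<close>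

lemma root_of_unity_min_poly:
  fixes z :: complex
  assumes "N > 0" "z ^ N = 1"
  obtains g h where "monom 1 N - 1 = g * h" "lead_coeff g = 1" "ieval g z = 0"
    "\<And>f. f \<noteq> 0 \<Longrightarrow> ieval f z = 0 \<Longrightarrow> degree g \<le> degree f"
proof -
  let ?X = "monom 1 N - 1 :: int poly"
  define P where "P f \<longleftrightarrow> f \<noteq> 0 \<and> ieval f z = 0" for f
  have lX: "lead_coeff ?X = 1" 
  proof -
    have "degree ?X = N"
      using assms by (intro antisym degree_le le_degree) (auto simp: coeff_eq_0)
    then show ?thesis using assms by simp
  qed
  then have PX: "P ?X" using assms by (auto simp: P_def)
  define g0 where "g0 = arg_min degree P"
  have Pg0: "P g0" and min0: "\<And>f. P f \<Longrightarrow> degree g0 \<le> degree f"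
    using arg_min_nat_lemma[of P, OF PX] by (auto simp: g0_def)
  define g1 where "g1 = primitive_part g0"
  have Pg1: "P g1"
  proof -
    have "ieval (smult (content g0) g1) z = 0"
      using Pg0 unfolding g1_def content_times_primitive_part by (simp add: P_def)
    then have "ieval g1 z = 0" using Pg0 unfolding ieval_smult by (simp add: P_def)
    then show ?thesis using Pg0 by (simp add: P_def g1_def)
  qed
  have min1: "degree g1 \<le> degree f" if "P f" for f
    using min0[OF that] by (simp add: g1_def)
  have cont: "content g1 = 1" using Pg0 by (simp add: g1_def P_def)
  have g1: "g1 \<noteq> 0" using Pg1 by (simp add: P_def)
  \<comment> \<open>Pseudo-division keeps the coefficients integral. The remainder vanishes at
    \<open>z\<close> and has smaller degree than \<open>g1\<close>, so it is zero.\<close>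
  obtain a q where aq: "a \<noteq> 0" "smult a ?X = g1 * q + pseudo_mod ?X g1"
    using pseudo_mod(1)[OF g1, of ?X] by auto
  have "ieval (smult a ?X) z = 0" using PX by (simp add: P_def)
  then have "ieval (pseudo_mod ?X g1) z = 0"
    using Pg1 unfolding aq(2) by (simp add: P_def)
  then have "pseudo_mod ?X g1 = 0"
    using pseudo_mod(2)[OF g1, of ?X] min1[of "pseudo_mod ?X g1"] by (force simp: P_def)
  then have eq: "smult a ?X = g1 * q" using aq by simp
  \<comment> \<open>Both \<open>?X\<close> and \<open>g1\<close> are primitive, so comparing
    contents moves the factor \<open>a\<close> entirely into \<open>q\<close>, where it can be
    cancelled.\<close>
  have "content ?X = 1"
    using lX by (metis content_dvd_coeff is_unit_content_iff)
  then have "content q = normalize a"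
    using arg_cong[OF eq, of content] cont by (simp add: content_mult)
  then have "normalize a dvd content q" by simp
  then have "[:a:] dvd q" by (simp add: const_poly_dvd_iff_dvd_content)
  then obtain h1 where "q = smult a h1" by (auto simp: dvd_def)
  then have X: "?X = g1 * h1" using eq aq(1) by (metis mult_smult_right smult_cancel)
  have lc: "lead_coeff g1 * lead_coeff h1 = 1" using lX unfolding X lead_coeff_mult .
  \<comment> \<open>\<open>u\<close> is 1 or -1; multiplying both factors by \<open>u\<close> makes
    \<open>g1\<close> monic and leaves the product unchanged.\<close>
  define u where "u = lead_coeff g1"
  have uu: "u * u = 1" using lc unfolding u_def by (metis zmult_eq_1_iff mult_1 mult_minus1 minus_minus)
  show ?thesis
  proof
    show "?X = smult u g1 * smult u h1" using uu X by simp
    show "lead_coeff (smult u g1) = 1" using uu by (simp add: u_def g1)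
    show "ieval (smult u g1) z = 0" using Pg1 by (simp add: P_def)
    show "degree (smult u g1) \<le> degree f" if "f \<noteq> 0" "ieval f z = 0" for f
    proof -
      have "u \<noteq> 0" using uu by auto
      then show ?thesis using min1[of f] that by (simp add: P_def)
    qed
  qed
qed

text \<open>
  Write \<open>X ^ N - 1 = g * h\<close> with \<open>g\<close> the minimal polynomial of \<open>z\<close>. If \<open>g (z ^ q) \<noteq> 0\<close> then
  \<open>h (z ^ q) = 0\<close>, so Frobenius makes \<open>h z ^ q\<close> divisible by \<open>q\<close> in \<open>\<int>[z]\<close>. Differentiating
  at \<open>z\<close> shows that \<open>h z\<close> divides \<open>N\<close>, hence \<open>q\<close> divides \<open>N ^ q\<close> in \<open>\<int>[z]\<close>, and so in \<open>\<int>\<close>.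
\<close>

lemma ieval_conjugate_prime:
  fixes z :: complex
  assumes N: "N > 0" "z ^ N = 1" and q: "prime q" "\<not> q dvd N" and f: "ieval f z = 0"
  shows "ieval f (z ^ q) = 0"
proof -
  obtain g h where X: "monom 1 N - 1 = g * h" and lg: "lead_coeff g = 1" and gz: "ieval g z = 0"
    and gmin: "\<And>f. f \<noteq> 0 \<Longrightarrow> ieval f z = 0 \<Longrightarrow> degree g \<le> degree f"
    using root_of_unity_min_poly[OF N] by blast
  have g0: "g \<noteq> 0" using lg by auto
  \<comment> \<open>For a monic divisor, pseudo-division is genuine division with remainder over the
    integers.\<close>
  have division: "\<exists>s r. p = g * s + r \<and> (r = 0 \<or> degree r < degree g)" for p
  proof -
    obtain s r where "pseudo_divmod p g = (s, r)" by fastforce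
    from pseudo_divmod[OF g0 this] lg show ?thesis by auto
  qed
  have div0: "\<exists>s. p = g * s" if "ieval p z = 0" for p
  proof -
    obtain s r where sr: "p = g * s + r" "r = 0 \<or> degree r < degree g" using division by blast
    then have "ieval r z = 0" using that gz by simp
    then have "r = 0" using sr(2) gmin[of r] by force
    then show ?thesis using sr by auto
  qed
  have "ieval g (z ^ q) = 0"
  proof (rule ccontr)
    assume ne: "ieval g (z ^ q) \<noteq> 0"
    have "ieval (monom 1 N - 1) (z ^ q) = 0"
      using N by (simp flip: power_mult add: mult.commute) (simp add: power_mult)
    then have hq: "ieval h (z ^ q) = 0" using ne unfolding X by simp
    obtain u where "h ^ q - pcompose h (monom 1 q) = of_nat q * u"
      using prime_dvd_frobenius[OF q(1)] by (auto simp: dvd_def)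
    then have "ieval (h ^ q - pcompose h (monom 1 q)) z = ieval (of_nat q * u) z" by simp
    then have hz: "ieval h z ^ q = of_nat q * ieval u z"
      using hq by (simp add: of_nat_poly)
    have "pderiv (monom 1 N - 1) = pderiv (g * h)" using X by simp
    then have "ieval (pderiv (monom 1 N - 1)) z = ieval (pderiv (g * h)) z" by simp
    then have dz: "of_nat N * z ^ (N - 1) = ieval (pderiv g) z * ieval h z"
      using gz by (simp add: pderiv_diff pderiv_monom pderiv_mult)
    have "of_nat N = z * (of_nat N * z ^ (N - 1))"
      using N by (metis mult.left_commute mult.right_neutral power_eq_if not_gr_zero)
    then have "of_nat N = z * ieval (pderiv g) z * ieval h z"
      unfolding dz by (simp only: mult.assoc)
    then have "of_nat N ^ q = (z * ieval (pderiv g) z) ^ q * (of_nat q * ieval u z)"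
      unfolding hz[symmetric] by (simp add: power_mult_distrib)
    also have "\<dots> = ieval ([:0, 1:] ^ q * pderiv g ^ q * smult (int q) u) z"
      by (simp add: power_mult_distrib)
    finally obtain w where w: "of_nat N ^ q = ieval (smult (int q) w) z"
      by (metis ieval_smult mult_smult_right)
    obtain s r where sr: "w = g * s + r" "r = 0 \<or> degree r < degree g" using division by blast
    \<comment> \<open>Reducing \<open>w\<close> modulo \<open>g\<close> turns the equality of values
      at \<open>z\<close> into a polynomial of degree below \<open>degree g\<close> vanishing at
      \<open>z\<close>. It must be the zero polynomial, and its constant coefficient shows that
      \<open>q\<close> divides \<open>N ^ q\<close>.\<close>
    define v where "v = [:int N ^ q:] - smult (int q) r"
    have "ieval v z = 0" using w gz by (simp add: v_def sr)
    moreover have "degree g > 0"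
    proof (rule ccontr)
      assume "\<not> degree g > 0"
      then obtain c where "g = [:c:]" using degree_eq_zeroE by blast
      then have "g = 1" using lg by (simp add: one_pCons)
      then show False using gz by simp
    qed
    then have "degree v < degree g"
      using sr(2) unfolding v_def by (intro degree_diff_less) (auto intro: le_less_trans[OF degree_smult_le])
    ultimately have "v = 0" using gmin[of v] by force
    then have "coeff v 0 = 0" by simp
    then have "int q dvd int N ^ q" by (simp add: v_def)
    then have "q dvd N ^ q" by (metis int_dvd_int_iff of_nat_power)
    then show False using q prime_dvd_power_nat by blast
  qed
  moreover obtain s where "f = g * s" using div0[OF f] by blast
  ultimately show ?thesis by simp
qed

text \<open>The prime factors of \<open>j\<close> are applied one after another. Each replaces
  \<open>z\<close> by \<open>z ^ q\<close>, again an \<open>N\<close>-th root of unity, so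
  \<open>z\<close> is kept arbitrary. For \<open>j = 0\<close> coprimality forces
  \<open>N = 1\<close> and \<open>z = 1\<close>.\<close>

lemma ieval_conjugate:
  fixes z :: complex
  assumes "N > 0" "z ^ N = 1" "coprime j N" "ieval f z = 0"
  shows "ieval f (z ^ j) = 0"
  using assms
proof (induction j arbitrary: z rule: prime_divisors_induct)
  case zero
  then show ?case by simp
next
  case (unit j)
  then show ?case by simp
next
  case (factor q j)
  then have "\<not> q dvd N" by (metis coprime_mult_left_iff not_prime_unit coprime_absorb_left)
  moreover have "prime q" "coprime j N" using factor by (auto simp: coprime_mult_left_iff)
  ultimately have "ieval f (z ^ q) = 0" using factor.prems ieval_conjugate_prime by blast
  moreover have "(z ^ q) ^ N = 1" using factor.prems by (metis mult.commute power_mult power_one)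
  ultimately show ?case
    using factor.IH[of "z ^ q"] factor.prems \<open>coprime j N\<close> by (simp add: power_mult)
qed

subsection \<open>Mann's theorem\<close>

text \<open>Orthogonality of the additive characters modulo \<open>p\<close>, by the geometric sum.
  It is the Fourier inversion used in the proof of Mann's theorem.\<close>

lemma sum_cis_powers:
  assumes "p > 0"
  shows "(\<Sum>t<p. cis (2 * pi / real p) ^ (t * e)) = (if p dvd e then of_nat p else 0)"
proof -
  define w where "w = cis (2 * pi / real p)"
  have eq: "(\<Sum>t<p. w ^ (t * e)) = (\<Sum>t<p. (w ^ e) ^ t)"
    by (simp add: power_mult mult.commute flip: power_mult)
  have "(w ^ e) ^ p = (w ^ p) ^ e" by (simp add: mult.commute flip: power_mult)
  also have "w ^ p = 1" using assms by (simp add: w_def Complex.DeMoivre)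
  finally have wep: "(w ^ e) ^ p = 1" by simp
  show ?thesis
  proof (cases "p dvd e")
    case True
    then have "w ^ e = 1" using \<open>w ^ p = 1\<close> by (auto simp: power_mult)
    then show ?thesis using True eq by (simp add: w_def)
  next
    case False
    have "w ^ e \<noteq> 1"
    proof
      assume "w ^ e = 1"
      then have "w ^ (e mod p) = 1"
        using \<open>w ^ p = 1\<close> by (metis div_mult_mod_eq mult.commute mult_1 power_add power_mult power_one)
      then have "cis (2 * pi * real (e mod p) / real p) = 1"
        by (simp add: w_def Complex.DeMoivre algebra_simps)
      \<comment> \<open>Writing 1 as the root with index 0 makes the injectivity of the enumeration
        of the \<open>p\<close>-th roots of unity applicable.\<close>
      then have "cis (2 * pi * real (e mod p) / real p) = cis (2 * pi * real 0 / real p)" by simp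
      then have "e mod p = 0"
        using Complex.bij_betw_roots_unity[OF assms] assms
        by (auto simp: bij_betw_def inj_on_def dest!: bspec[of _ _ "e mod p"])
      then show False using False by auto
    qed
    then show ?thesis using eq False wep by (simp add: w_def geometric_sum)
  qed
qed

text \<open>The relation says that the integer polynomial with terms
  \<open>monom (c i) (e i)\<close> vanishes at \<open>z\<close>, so it may be conjugated.\<close>

lemma vanishing_sum_conjugate:
  fixes c :: "'i \<Rightarrow> int" and z :: complex
  assumes "N > 0" "z ^ N = 1" "coprime j N"
    and "(\<Sum>i\<in>I. of_int (c i) * z ^ e i) = 0"
  shows "(\<Sum>i\<in>I. of_int (c i) * z ^ (j * e i)) = 0"
proof -
  define f where "f = (\<Sum>i\<in>I. monom (c i) (e i))"
  have "ieval f z = 0" using assms(4) by (simp add: f_def ieval_sum)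
  then have "ieval f (z ^ j) = 0" using ieval_conjugate assms by blast
  then show ?thesis by (simp add: f_def ieval_sum power_mult)
qed

text \<open>
  With \<open>z\<close> a primitive \<open>N\<close>-th root of unity and \<open>w = z ^ M\<close>, the sum \<open>S t\<close> below is the image of
  the relation under \<open>z \<mapsto> z ^ (1 + t * M)\<close>. This is a conjugation for all \<open>t < p\<close> except at most
  one, which exists only if \<open>p\<close> does not divide \<open>M\<close>; then some residue class modulo \<open>p\<close> contains no
  exponent, as \<open>card I < p\<close>, and its Fourier coefficient forces the last \<open>S t\<close> to vanish too.
  Fourier inversion then isolates the terms with exponent divisible by \<open>p\<close>.
\<close>

lemma mann_reduce_exponent:
  fixes c :: "'i \<Rightarrow> int" and y :: "'i \<Rightarrow> complex"
  assumes fin: "finite I" and N: "N > 0" and roots: "\<And>i. i \<in> I \<Longrightarrow> y i ^ N = 1"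
    and van: "(\<Sum>i\<in>I. of_int (c i) * y i) = 0"
    and min: "\<And>J. J \<subset> I \<Longrightarrow> J \<noteq> {} \<Longrightarrow> (\<Sum>i\<in>J. of_int (c i) * y i) \<noteq> 0"
    and i0: "i0 \<in> I" "y i0 = 1"
    and p: "prime p" "N = p * M" "p dvd M \<or> card I < p"
    and i: "i \<in> I"
  shows "y i ^ M = 1"
proof -
  have p0: "p > 0" using p(1) prime_gt_0_nat by blast
  have M0: "M > 0" using N p by auto
  define z where "z = cis (2 * pi / real N)"
  define w where "w = cis (2 * pi / real p)"
  have zN: "z ^ N = 1" using N by (simp add: z_def Complex.DeMoivre)
  have zM: "z ^ M = w" using p0 M0 by (simp add: z_def w_def p(2) Complex.DeMoivre)
  have w0: "w \<noteq> 0" by (simp add: w_def)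
  have "\<exists>e<N. y i = z ^ e" if "i \<in> I" for i
  proof -
    have "y i \<in> {z. z ^ N = 1}" using roots[OF that] by simp
    then obtain e where "e < N" "y i = cis (2 * pi * real e / real N)"
      using Complex.bij_betw_roots_unity[OF N] by (auto simp: bij_betw_def)
    then show ?thesis by (auto simp: z_def Complex.DeMoivre algebra_simps)
  qed
  then obtain e where e: "\<And>i. i \<in> I \<Longrightarrow> e i < N \<and> y i = z ^ e i" by metis
  define S where "S t = (\<Sum>i\<in>I. of_int (c i) * y i * w ^ (t * e i))" for t
  have fourier: "(\<Sum>t<p. S t * w ^ (t * s)) =
      of_nat p * (\<Sum>i | i \<in> I \<and> p dvd (e i + s). of_int (c i) * y i)" for s
  proof -
    have "(\<Sum>t<p. S t * w ^ (t * s)) =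
        (\<Sum>t<p. \<Sum>i\<in>I. of_int (c i) * y i * w ^ (t * (e i + s)))"
      unfolding S_def sum_distrib_right
      by (intro sum.cong refl) (simp add: distrib_left power_add mult.assoc)
    also have "\<dots> = (\<Sum>i\<in>I. of_int (c i) * y i * (\<Sum>t<p. w ^ (t * (e i + s))))"
      by (subst sum.swap) (simp add: sum_distrib_left)
    also have "\<dots> = (\<Sum>i\<in>I. if p dvd (e i + s) then of_nat p * (of_int (c i) * y i) else 0)"
      unfolding w_def sum_cis_powers[OF p0] by (intro sum.cong) (auto simp: mult_ac)
    also have "\<dots> = of_nat p * (\<Sum>i | i \<in> I \<and> p dvd (e i + s). of_int (c i) * y i)"
      unfolding sum.inter_filter[OF fin] sum_distrib_left by (intro sum.cong) auto
    finally show ?thesis .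
  qed
  have S_good: "S t = 0" if "\<not> p dvd (1 + t * M)" for t
  proof -
    \<comment> \<open>The exponent is 1 modulo \<open>M\<close>, so \<open>p\<close> is the only
      prime factor of \<open>N\<close> that could divide it.\<close>
    have "coprime (1 + t * M) M"
    proof (rule coprimeI)
      fix d assume "d dvd 1 + t * M" "d dvd M"
      then show "is_unit d" using dvd_add_left_iff[of d "t * M" 1] by simp
    qed
    moreover have "coprime (1 + t * M) p"
      using that p(1) prime_imp_coprime coprime_commute by blast
    ultimately have "coprime (1 + t * M) N" unfolding p(2) by simp
    moreover have "(\<Sum>i\<in>I. of_int (c i) * z ^ e i) = 0"
      using van e by simp
    ultimately have "(\<Sum>i\<in>I. of_int (c i) * z ^ ((1 + t * M) * e i)) = 0"
      using vanishing_sum_conjugate[OF N zN] by blast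
    also have "(\<Sum>i\<in>I. of_int (c i) * z ^ ((1 + t * M) * e i)) = S t"
      unfolding S_def
    proof (rule sum.cong)
      fix i assume "i \<in> I"
      have "z ^ ((1 + t * M) * e i) = z ^ e i * (z ^ M) ^ (t * e i)"
        by (simp add: algebra_simps flip: power_add power_mult)
      then show "of_int (c i) * z ^ ((1 + t * M) * e i) = of_int (c i) * y i * w ^ (t * e i)"
        using e \<open>i \<in> I\<close> zM by simp
    qed simp
    finally show ?thesis .
  qed
  have S0: "S t = 0" if t: "t < p" for t
  proof (cases "p dvd (1 + t * M)")
    case bad: True
    then have pM: "\<not> p dvd M"
      using p(1) by (metis dvd_add_left_iff dvd_mult not_prime_unit)
    \<comment> \<open>\<open>B\<close> collects the residues of \<open>- e i\<close> modulo
      \<open>p\<close>; the outer \<open>mod\<close> sends the value \<open>p\<close> to 0. For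
      \<open>s\<close> outside \<open>B\<close> the Fourier sum on the right of
      \<open>fourier\<close> is empty.\<close>
    define B where "B = (\<lambda>i. (p - e i mod p) mod p) ` I"
    have "card B < card {..<p}"
      using p(3) pM fin card_image_le[of I] unfolding B_def by (auto intro: le_less_trans)
    then obtain s where s: "s < p" "s \<notin> B"
      by (metis B_def card_mono fin finite_imageI lessThan_iff not_le subsetI)
    have "\<not> p dvd (e i + s)" if "i \<in> I" for i
    proof
      assume d: "p dvd (e i + s)"
      have "p dvd (e i mod p + s)" using d by (metis mod_add_left_eq mod_0_imp_dvd dvd_imp_mod_0)
      moreover have "e i mod p < p" using p0 by simp
      ultimately obtain k where k: "e i mod p + s = p * k" by (auto simp: dvd_def)
      then have "p * k < p * 2" using \<open>e i mod p < p\<close> s by linarith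
      then have "k = 0 \<or> k = 1" by auto
      then have "s = (p - e i mod p) mod p" using k s by auto
      then show False using s that by (auto simp: B_def)
    qed
    then have "(\<Sum>t<p. S t * w ^ (t * s)) = 0"
      unfolding fourier by (auto intro!: sum.neutral)
    moreover have "S t' * w ^ (t' * s) = 0" if "t' \<in> {..<p} - {t}" for t'
    proof -
      \<comment> \<open>If \<open>p\<close> divided both numbers it would divide
        \<open>(t' - t) * M\<close>, hence \<open>t' - t\<close>, although \<open>t\<close> and
        \<open>t'\<close> are distinct residues.\<close>
      have "\<not> p dvd (1 + t' * M)"
      proof
        assume "p dvd (1 + t' * M)"
        then have "int p dvd int (1 + t' * M) - int (1 + t * M)"
          using bad by (meson dvd_diff int_dvd_int_iff)
        then have "int p dvd (int t' - int t) * int M" by (simp add: algebra_simps)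
        then have "int p dvd (int t' - int t)"
          using p(1) pM by (metis int_dvd_int_iff prime_dvd_multD prime_nat_int_transfer)
        then show False using that t
          by (metis Diff_iff abs_of_nat diff_0_right int_ops(1) lessThan_iff mod_less mod_eq_dvd_iff of_nat_eq_iff of_nat_mod singletonI)
      qed
      then show ?thesis using S_good by simp
    qed
    ultimately have "S t * w ^ (t * s) = 0"
      using t by (subst (asm) sum.remove[of _ t]) (auto simp del: mult_eq_0_iff)
    then show ?thesis using w0 by simp
  qed (rule S_good)
  define J where "J = {i \<in> I. p dvd e i}"
  have "of_nat p * (\<Sum>i\<in>J. of_int (c i) * y i) = 0"
    using fourier[of 0] S0 by (simp add: J_def)
  then have "(\<Sum>i\<in>J. of_int (c i) * y i) = 0" using p0 by simp
  moreover have "i0 \<in> J"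
  proof -
    have "z ^ e i0 = 1" using e i0 by metis
    then have "cis (2 * pi * real (e i0) / real N) = cis (2 * pi * real 0 / real N)"
      by (simp add: z_def Complex.DeMoivre algebra_simps)
    then have "e i0 = 0"
      using Complex.bij_betw_roots_unity[OF N] e[OF i0(1)] N unfolding bij_betw_def inj_on_def by blast
    then show ?thesis using i0 by (simp add: J_def)
  qed
  moreover have "J \<subseteq> I" by (auto simp: J_def)
  ultimately have "J = I" using min by blast
  then obtain k where "e i = p * k" using i by (auto simp: J_def dvd_def)
  then have "y i ^ M = (z ^ N) ^ k" using e[OF i] p(2) by (simp add: mult_ac flip: power_mult)
  then show ?thesis using zN by simp
qed

section \<open>Squarefree orders, and Mann's theorem for integer, then rational,
  coefficients\<close>

definition primorial :: "nat \<Rightarrow> nat" where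
  "primorial m = \<Prod>{p. prime p \<and> p \<le> m}"

lemma dvd_primorial:
  fixes N :: nat
  assumes "N > 0" "\<And>p. prime p \<Longrightarrow> p dvd N \<Longrightarrow> p \<le> m \<and> \<not> p ^ 2 dvd N"
  shows "N dvd primorial m"
proof -
  have "N = (\<Prod>p\<in>prime_factors N. p ^ multiplicity p N)"
    using assms(1) by (simp add: prime_factorization_nat)
  also have "\<dots> = \<Prod>(prime_factors N)"
  proof (rule prod.cong)
    fix p assume "p \<in> prime_factors N"
    then have "prime p" "p dvd N" by auto
    moreover from this have "multiplicity p N > 0"
      using assms(1) by (simp add: prime_multiplicity_gt_zero_iff)
    ultimately have "multiplicity p N = 1"
      using assms(2)[of p] multiplicity_dvd'[of 2 p N] by force
    then show "p ^ multiplicity p N = p" by simp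
  qed simp
  finally have N: "N = \<Prod>(prime_factors N)" .
  have "\<Prod>(prime_factors N) dvd primorial m"
    unfolding primorial_def using assms by (intro prod_dvd_prod_subset) auto
  then show ?thesis using N by simp
qed

text \<open>Divide by \<open>z j\<close> and take the least common exponent \<open>m\<close> of all
  ratios. If a prime \<open>p\<close> dividing \<open>m\<close> had \<open>p ^ 2 dvd m\<close> or
  \<open>p > card I\<close>, then \<open>mann_reduce_exponent\<close> would make
  \<open>m / p\<close> a smaller one.\<close>

lemma mann_int:
  fixes c :: "'i \<Rightarrow> int" and z :: "'i \<Rightarrow> complex"
  assumes fin: "finite I" and roots: "\<And>i. i \<in> I \<Longrightarrow> \<exists>N>0. z i ^ N = 1"
    and van: "(\<Sum>i\<in>I. of_int (c i) * z i) = 0"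
    and min: "\<And>J. J \<subset> I \<Longrightarrow> J \<noteq> {} \<Longrightarrow> (\<Sum>i\<in>J. of_int (c i) * z i) \<noteq> 0"
    and i: "i \<in> I" "j \<in> I"
  shows "(z i / z j) ^ primorial (card I) = 1"
proof -
  obtain N where N: "\<And>i. i \<in> I \<Longrightarrow> N i > 0 \<and> z i ^ N i = 1" using roots by metis
  define y where "y i = z i / z j" for i
  define P where "P n \<longleftrightarrow> n > 0 \<and> (\<forall>i\<in>I. y i ^ n = 1)" for n
  have zj: "z j \<noteq> 0" using N[OF i(2)] by (metis power_0_left less_numeral_extra(3) zero_neq_one)
  have y: "(\<Sum>i\<in>J. of_int (c i) * y i) = (\<Sum>i\<in>J. of_int (c i) * z i) / z j" for J
    by (simp add: y_def sum_divide_distrib)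
  have "P (prod N I)" unfolding P_def
  proof safe
    show "prod N I > 0" using N by (simp add: prod_pos)
    have *: "z k ^ prod N I = 1" if "k \<in> I" for k
    proof -
      have "N k dvd prod N I" using fin that by (simp add: dvd_prodI)
      then show ?thesis using N[OF that] by (auto simp: power_mult elim!: dvdE)
    qed
    show "y k ^ prod N I = 1" if "k \<in> I" for k
      using * that i by (simp add: y_def power_divide)
  qed
  define m where "m = (LEAST n. P n)"
  have Pm: "P m" and least: "\<And>n. P n \<Longrightarrow> m \<le> n"
    using \<open>P (prod N I)\<close> by (auto simp: m_def intro: LeastI Least_le)
  have "m dvd primorial (card I)"
  proof (rule dvd_primorial)
    show "m > 0" using Pm by (simp add: P_def)
    fix p assume p: "prime p" "p dvd m"
    then obtain M where M: "m = p * M" by (auto simp: dvd_def)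
    show "p \<le> card I \<and> \<not> p ^ 2 dvd m"
    proof (rule ccontr)
      assume "\<not> ?thesis"
      then have "p dvd M \<or> card I < p"
        using M p prime_gt_0_nat[OF p(1)] by (auto simp: power2_eq_square)
      then have "\<forall>i\<in>I. y i ^ M = 1"
        using mann_reduce_exponent[OF fin \<open>m > 0\<close>, of y c j p M] Pm van min i p M zj
        unfolding y P_def by (auto simp: y_def)
      moreover have "M > 0" "M < m" using M \<open>m > 0\<close> prime_gt_1_nat[OF p(1)] by auto
      ultimately show False using least[of M] by (simp add: P_def)
    qed
  qed
  then show ?thesis using Pm i by (auto simp: P_def y_def power_mult elim!: dvdE)
qed

text \<open>A common denominator \<open>D\<close> multiplies every subsum by the same nonzero
  factor, so vanishing and minimality pass to integer coefficients.\<close>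

theorem mann:
  fixes c :: "'i \<Rightarrow> real" and z :: "'i \<Rightarrow> complex"
  assumes fin: "finite I" and roots: "\<And>i. i \<in> I \<Longrightarrow> \<exists>N>0. z i ^ N = 1"
    and rat: "\<And>i. i \<in> I \<Longrightarrow> c i \<in> \<rat>"
    and van: "(\<Sum>i\<in>I. of_real (c i) * z i) = 0"
    and min: "\<And>J. J \<subset> I \<Longrightarrow> J \<noteq> {} \<Longrightarrow> (\<Sum>i\<in>J. of_real (c i) * z i) \<noteq> 0"
    and i: "i \<in> I" "j \<in> I"
  shows "(z i / z j) ^ primorial (card I) = 1"
proof -
  have "\<exists>d>0::int. d * c i \<in> \<int>" if "i \<in> I" for i
  proof -
    obtain a b :: int where "b > 0" "c i = a / b" using rat[OF \<open>i \<in> I\<close>] by (elim Rats_cases') auto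
    then show ?thesis by (intro exI[of _ b]) auto
  qed
  then obtain d :: "'i \<Rightarrow> int" where d: "\<And>i. i \<in> I \<Longrightarrow> d i > 0 \<and> d i * c i \<in> \<int>" by metis
  define D where "D = prod d I"
  have D: "D \<noteq> 0" using d fin by (force simp: D_def)
  have "\<exists>a::int. D * c i = a" if "i \<in> I" for i
  proof -
    have "D = prod d (I - {i}) * d i" using that fin by (simp add: D_def prod.remove mult.commute)
    then have "D * c i = prod d (I - {i}) * (d i * c i)" by simp
    also have "\<dots> \<in> \<int>" using d[OF that] by (blast intro: Ints_mult Ints_of_int)
    finally show ?thesis by (auto elim: Ints_cases)
  qed
  then obtain a :: "'i \<Rightarrow> int" where a: "\<And>i. i \<in> I \<Longrightarrow> D * c i = a i" by metis
  have eq: "(\<Sum>i\<in>J. of_int (a i) * z i) = of_int D * (\<Sum>i\<in>J. of_real (c i) * z i)" if "J \<subseteq> I" for J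
    unfolding sum_distrib_left
  proof (rule sum.cong)
    fix i assume "i \<in> J"
    then have "of_int (a i) = complex_of_real (D * c i)"
      using a[of i] that by (metis of_real_of_int_eq subsetD)
    then show "of_int (a i) * z i = of_int D * (of_real (c i) * z i)" by simp
  qed simp
  show ?thesis
  proof (rule mann_int[OF fin roots _ _ i])
    show "(\<Sum>i\<in>I. of_int (a i) * z i) = 0" using eq[of I] van by simp
    show "(\<Sum>i\<in>J. of_int (a i) * z i) \<noteq> 0" if "J \<subset> I" "J \<noteq> {}" for J
      using eq[of J] min[OF that] that D by auto
  qed
qed

text \<open>In the difference of the two sums, a smallest vanishing subfamily through
  \<open>i\<close> cannot lie inside \<open>A\<close> by \<open>irr\<close>, so it contains some
  \<open>j\<close> from \<open>B\<close>; Mann's theorem then compares \<open>z i\<close> with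
  \<open>w j\<close>.\<close>

lemma two_representations:
  fixes a :: "'i \<Rightarrow> real" and b :: "'j \<Rightarrow> real" and z :: "'i \<Rightarrow> complex" and w :: "'j \<Rightarrow> complex"
  assumes fin: "finite A" "finite B"
    and A: "\<And>i. i \<in> A \<Longrightarrow> a i \<in> \<rat> \<and> (\<exists>N>0. z i ^ N = 1)"
    and B: "\<And>j. j \<in> B \<Longrightarrow> b j \<in> \<rat> \<and> (\<exists>N>0. w j ^ N = 1)"
    and eq: "(\<Sum>i\<in>A. of_real (a i) * z i) = (\<Sum>j\<in>B. of_real (b j) * w j)"
    and irr: "\<And>J. J \<subseteq> A \<Longrightarrow> J \<noteq> {} \<Longrightarrow> (\<Sum>i\<in>J. of_real (a i) * z i) \<noteq> 0"
    and i: "i \<in> A"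
  shows "\<exists>j\<in>B. (z i / w j) ^ primorial (card A + card B) = 1"
proof -
  define c where "c = case_sum a (\<lambda>j. - b j)"
  define u where "u = case_sum z w"
  define V where "V J \<longleftrightarrow> Inl i \<in> J \<and> J \<subseteq> A <+> B \<and> (\<Sum>k\<in>J. of_real (c k) * u k) = 0" for J
  have finAB: "finite (A <+> B)" using fin by simp
  have "V (A <+> B)"
    using fin i eq by (auto simp: V_def sum.Plus c_def u_def sum_negf)
  define J where "J = arg_min card V"
  have VJ: "V J" and min: "\<And>K. V K \<Longrightarrow> card J \<le> card K"
    using arg_min_nat_lemma[of V, OF \<open>V (A <+> B)\<close>] by (auto simp: J_def)
  have finJ: "finite J" using VJ finite_subset[OF _ finAB] by (simp add: V_def)
  \<comment> \<open>Minimality among subfamilies containing \<open>Inl i\<close> is enough: a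
    vanishing part and its complement in \<open>J\<close> both vanish, and one of them contains
    \<open>Inl i\<close>.\<close>
  have minJ: "(\<Sum>k\<in>K. of_real (c k) * u k) \<noteq> 0" if K: "K \<subset> J" "K \<noteq> {}" for K
  proof
    assume 0: "(\<Sum>k\<in>K. of_real (c k) * u k) = 0"
    have "(\<Sum>k\<in>J - K. of_real (c k) * u k) = 0"
      using K VJ 0 finJ by (subst sum_diff) (auto simp: V_def)
    then have "V K \<or> V (J - K)" using VJ K 0 by (auto simp: V_def)
    moreover have "card K < card J" using K finJ by (simp add: psubset_card_mono)
    moreover have "card (J - K) < card J" using K finJ by (intro psubset_card_mono) auto
    ultimately show False using min by (meson not_le)
  qed
  have "\<exists>j\<in>B. Inr j \<in> J"
  proof (rule ccontr)
    assume no: "\<not> ?thesis"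
    define J' where "J' = Inl -` J"
    have "k \<in> Inl ` J'" if "k \<in> J" for k
    proof -
      have "k \<in> A <+> B" using VJ that by (auto simp: V_def)
      then show ?thesis using no that by (elim PlusE) (auto simp: J'_def)
    qed
    then have J: "J = Inl ` J'" by (auto simp: J'_def)
    then have "(\<Sum>k\<in>J'. of_real (a k) * z k) = 0"
      using VJ unfolding V_def J by (simp add: sum.reindex c_def u_def)
    moreover have "J' \<subseteq> A" "J' \<noteq> {}" using VJ by (auto simp: V_def J'_def)
    ultimately show False using irr by blast
  qed
  then obtain j where j: "j \<in> B" "Inr j \<in> J" by blast
  have "(u (Inl i) / u (Inr j)) ^ primorial (card J) = 1"
  proof (rule mann[OF finJ])
    fix k assume "k \<in> J"
    then have k: "k \<in> A <+> B" using VJ by (auto simp: V_def)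
    show "\<exists>N>0. u k ^ N = 1" using k A B by (elim PlusE) (simp_all add: u_def)
    show "c k \<in> \<rat>" using k A B by (elim PlusE) (simp_all add: c_def)
  next
    show "(\<Sum>k\<in>J. of_real (c k) * u k) = 0" "Inl i \<in> J" using VJ by (simp_all add: V_def)
  qed (fact minJ j(2))+
  moreover have "primorial (card J) dvd primorial (card A + card B)"
  proof -
    have "card J \<le> card (A <+> B)" using VJ finAB by (intro card_mono) (auto simp: V_def)
    then have "card J \<le> card A + card B" using fin by (simp add: card_Plus)
    then show ?thesis unfolding primorial_def by (intro prod_dvd_prod_subset) auto
  qed
  ultimately have "(u (Inl i) / u (Inr j)) ^ primorial (card A + card B) = 1"
    by (metis dvdE power_mult power_one)
  then show ?thesis using j by (auto simp: u_def)
qed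

subsection \<open>The product of the primes up to a bound\<close>

lemma primorial_pos: "primorial m > 0"
  unfolding primorial_def by (intro prod_pos) (auto simp: prime_gt_0_nat)

lemma prod_primes_dvd:
  fixes A :: "nat set"
  assumes "finite A" "\<And>p. p \<in> A \<Longrightarrow> prime p \<and> p dvd n"
  shows "\<Prod>A dvd n"
  using assms
proof (induction A)
  case (insert p A)
  then have "coprime p (\<Prod>A)" by (intro prod_coprime_right primes_coprime) auto
  then show ?case using insert by (simp add: divides_mult)
qed simp

text \<open>The two equal middle coefficients together are at most the row sum
  \<open>2 ^ (2 * k + 1)\<close>.\<close>

lemma binomial_odd_middle_le: "(2 * k + 1 choose k) \<le> 4 ^ k"
proof -
  have "2 * (2 * k + 1 choose k) = (\<Sum>i\<in>{k, k + 1}. 2 * k + 1 choose i)"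
    using binomial_symmetric[of k "2 * k + 1"] by simp
  also have "\<dots> \<le> (\<Sum>i\<le>2 * k + 1. 2 * k + 1 choose i)"
    by (intro sum_mono2) auto
  also have "\<dots> = 2 * 4 ^ k" using choose_row_sum[of "2 * k + 1"] by (simp add: power_mult)
  finally show ?thesis by simp
qed

text \<open>Erdos's induction. An even \<open>m > 2\<close> adds no prime. For
  \<open>m = 2 * k + 1\<close> the primes above \<open>k + 1\<close> divide \<open>m\<close>
  factorial but neither \<open>fact k\<close> nor \<open>fact (k + 1)\<close>, so their product
  divides \<open>m choose k\<close>.\<close>

lemma primorial_le: "primorial m \<le> 4 ^ m"
proof (induction m rule: less_induct)
  case (less m)
  show ?case
  proof (cases "m \<le> 2")
    case True
    then consider "m < 2" | "m = 2" by linarith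
    then show ?thesis
    proof cases
      case 2
      then have "{p. prime p \<and> p \<le> m} = {2::nat}"
        by (auto dest: prime_ge_2_nat)
      then show ?thesis using 2 by (simp add: primorial_def)
    next
      case 1
      then have none: "{p. prime p \<and> p \<le> m} = {}" by (auto dest: prime_ge_2_nat)
      show ?thesis unfolding primorial_def none by simp
    qed
  next
    case m: False
    show ?thesis
    proof (cases "even m")
      case True
      then have "\<not> prime m" using m prime_odd_nat by auto
      then have "{p. prime p \<and> p \<le> m} = {p. prime p \<and> p \<le> m - 1}"
        using le_eq_less_or_eq by auto
      then have "primorial m = primorial (m - 1)" by (simp add: primorial_def)
      also have "\<dots> \<le> 4 ^ (m - 1)" using less m by simp
      also have "\<dots> \<le> 4 ^ m" by (intro power_increasing) auto
      finally show ?thesis .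
    next
      case False
      then obtain k where k: "m = 2 * k + 1" by (auto elim: oddE)
      define A where "A = {p. prime p \<and> k + 1 < p \<and> p \<le> m}"
      have fin: "finite A" by (rule finite_subset[of _ "{..m}"]) (auto simp: A_def)
      have "{p. prime p \<and> p \<le> m} = {p. prime p \<and> p \<le> k + 1} \<union> A"
        using k by (auto simp: A_def)
      then have "primorial m = primorial (k + 1) * \<Prod>A"
        unfolding primorial_def using fin by (simp add: prod.union_disjoint A_def disjoint_iff)
      moreover have "\<Prod>A dvd (m choose k)"
      proof (rule prod_primes_dvd[OF fin])
        fix p assume p: "p \<in> A"
        then have "p dvd fact m" by (simp add: A_def prime_dvd_fact_iff)
        also have "fact m = fact k * fact (k + 1) * (m choose k)"
          using binomial_fact_lemma[of k m] k by simp
        finally have "p dvd fact k \<or> p dvd fact (k + 1) \<or> p dvd (m choose k)"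
          using p by (simp add: A_def prime_dvd_mult_iff del: fact_Suc)
        moreover have "\<not> p dvd fact k" "\<not> p dvd fact (k + 1)"
          using p by (simp_all add: A_def prime_dvd_fact_iff del: fact_Suc)
        ultimately show "prime p \<and> p dvd (m choose k)" using p by (simp add: A_def)
      qed
      then have "\<Prod>A \<le> (m choose k)" using k by (intro dvd_imp_le) (auto simp: zero_less_binomial)
      then have "\<Prod>A \<le> 4 ^ k" using binomial_odd_middle_le[of k] k by simp
      moreover have "primorial (k + 1) \<le> 4 ^ (k + 1)" using less[of "k + 1"] m k by simp
      ultimately have "primorial m \<le> 4 ^ (k + 1) * 4 ^ k" by (simp add: mult_le_mono)
      also have "\<dots> = 4 ^ m" using k by (simp add: mult_2 flip: power_add)
      finally show ?thesis .
    qed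
  qed
qed

subsection \<open>Irredundant walks\<close>

definition edges :: "('a \<Rightarrow> 'a \<Rightarrow> bool) \<Rightarrow> 'a set \<Rightarrow> 'a set set" where
  "edges R S = {{p, q} | p q. p \<in> S \<and> q \<in> S \<and> p \<noteq> q \<and> R p q}"

lemma finite_edges: "finite S \<Longrightarrow> finite (edges R S)"
  by (rule finite_subset[of _ "Pow S"]) (auto simp: edges_def)

text \<open>Deleting a vertex of degree at most \<open>c\<close> loses at most \<open>c\<close>
  edges, so the strict edge bound survives and the deletion can be repeated until no such vertex is
  left.\<close>

lemma min_degree_subset:
  fixes c :: real
  assumes "finite S" "c \<ge> 0" "symp R" "c * card S < card (edges R S)"
  shows "\<exists>T\<subseteq>S. T \<noteq> {} \<and> (\<forall>v\<in>T. c < card {q \<in> T. q \<noteq> v \<and> R v q})"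
  using assms(1,4)
proof (induction S rule: finite_psubset_induct)
  case (psubset S)
  show ?case
  proof (cases "\<forall>v\<in>S. c < card {q \<in> S. q \<noteq> v \<and> R v q}")
    case True
    have "S \<noteq> {}" using psubset.prems by (auto simp: edges_def)
    then show ?thesis using True by blast
  next
    case False
    then obtain v where v: "v \<in> S" "card {q \<in> S. q \<noteq> v \<and> R v q} \<le> c"
      by (meson not_less)
    define D where "D = {q \<in> S. q \<noteq> v \<and> R v q}"
    have "edges R S \<subseteq> edges R (S - {v}) \<union> (\<lambda>q. {v, q}) ` D"
    proof
      fix e assume "e \<in> edges R S"
      then obtain p q where e: "e = {p, q}" "p \<in> S" "q \<in> S" "p \<noteq> q" "R p q"
        by (auto simp: edges_def)
      then have "R q p" using assms(3) by (blast dest: sympD)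
      then consider "p = v" "q \<in> D" | "q = v" "p \<in> D" | "p \<in> S - {v}" "q \<in> S - {v}"
        using e by (auto simp: D_def)
      then show "e \<in> edges R (S - {v}) \<union> (\<lambda>q. {v, q}) ` D"
      proof cases
        case 1
        then show ?thesis using e(1) by blast
      next
        case 2
        then have "e = {v, p}" using e(1) by blast
        then show ?thesis using 2 by blast
      next
        case 3
        then have "e \<in> edges R (S - {v})" using e unfolding edges_def by blast
        then show ?thesis by blast
      qed
    qed
    then have "card (edges R S) \<le> card (edges R (S - {v}) \<union> (\<lambda>q. {v, q}) ` D)"
      using psubset.hyps by (intro card_mono) (auto simp: finite_edges D_def)
    also have "\<dots> \<le> card (edges R (S - {v})) + card ((\<lambda>q. {v, q}) ` D)"
      by (rule card_Un_le)
    also have "card ((\<lambda>q. {v, q}) ` D) \<le> card D"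
      using psubset.hyps by (intro card_image_le) (auto simp: D_def)
    finally have "card (edges R S) \<le> card (edges R (S - {v})) + c"
      using v by (simp add: D_def)
    moreover have "real (card S) = card (S - {v}) + 1"
      using card_Suc_Diff1[OF psubset.hyps v(1)] by linarith
    ultimately have "c * card (S - {v}) < card (edges R (S - {v}))"
      using psubset.prems by (simp add: algebra_simps)
    then obtain T where "T \<subseteq> S - {v}" "T \<noteq> {}" "\<forall>v\<in>T. c < card {q \<in> T. q \<noteq> v \<and> R v q}"
      using psubset.IH[of "S - {v}"] v(1) by auto
    then show ?thesis by (meson Diff_subset subset_trans)
  qed
qed

text \<open>Walks are lists whose head is the current end point and whose last element is the start.\<close>

fun walks :: "('a list \<Rightarrow> 'a set) \<Rightarrow> 'a \<Rightarrow> nat \<Rightarrow> 'a list set" where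
  "walks F v 0 = {[v]}"
| "walks F v (Suc k) = (\<lambda>(xs, x). x # xs) ` (SIGMA xs:walks F v k. F xs)"

section \<open>Counting walks by their continuations\<close>

lemma finite_walks: "(\<And>xs. finite (F xs)) \<Longrightarrow> finite (walks F v k)"
  by (induction k) auto

lemma card_walks_Suc:
  assumes "\<And>xs. finite (F xs)"
  shows "card (walks F v (Suc k)) = (\<Sum>xs\<in>walks F v k. card (F xs))"
  using assms finite_walks[of F v k, OF assms]
  by (simp add: card_image inj_on_def)

lemma card_walks_le:
  assumes "\<And>xs. finite (F xs)" "\<And>xs. real (card (F xs)) \<le> m"
  shows "real (card (walks F v k)) \<le> m ^ k"
proof (induction k)
  case (Suc k)
  have m: "m \<ge> 0" using assms(2)[of "[]"] by linarith
  have "real (card (walks F v (Suc k))) = (\<Sum>xs\<in>walks F v k. real (card (F xs)))"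
    using card_walks_Suc[of F v k, OF assms(1)] by simp
  also have "\<dots> \<le> card (walks F v k) * m"
    using assms(2) by (intro sum_bounded_above)
  also have "\<dots> \<le> m ^ k * m" using Suc m by (intro mult_right_mono)
  finally show ?case by (simp add: mult.commute)
qed simp

lemma card_walks_ge:
  assumes "\<And>xs. finite (F xs)" "m \<ge> 0"
    and "\<And>j xs. j < k \<Longrightarrow> xs \<in> walks F v j \<Longrightarrow> m \<le> real (card (F xs))"
  shows "m ^ k \<le> real (card (walks F v k))"
  using assms(3)
proof (induction k)
  case (Suc k)
  have "m ^ Suc k = m ^ k * m" by simp
  also have "\<dots> \<le> card (walks F v k) * m"
  proof (rule mult_right_mono)
    show "m ^ k \<le> card (walks F v k)" using Suc.prems by (intro Suc.IH) (meson less_SucI)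
  qed (rule assms(2))
  also have "\<dots> \<le> (\<Sum>xs\<in>walks F v k. real (card (F xs)))"
    using Suc.prems by (intro sum_bounded_below) auto
  also have "\<dots> = real (card (walks F v (Suc k)))"
    using card_walks_Suc[of F v k, OF assms(1)] by simp
  finally show ?case .
qed simp

text \<open>Lists grow at the head, so \<open>drop (Suc i) xs\<close> is the walk before
  \<open>xs ! i\<close> was chosen. This local criterion lets walks for one rule be recognised as
  walks for another.\<close>

lemma walksI:
  assumes "length xs = Suc k" "last xs = v" "\<And>i. i < k \<Longrightarrow> xs ! i \<in> F (drop (Suc i) xs)"
  shows "xs \<in> walks F v k"
  using assms
proof (induction k arbitrary: xs)
  case 0
  then show ?case by (auto simp: length_Suc_conv)
next
  case (Suc k)
  then obtain x ys where xs: "xs = x # ys" "length ys = Suc k" by (auto simp: length_Suc_conv)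
  moreover have "last ys = v" using Suc.prems(2) xs by auto
  moreover have "ys ! i \<in> F (drop (Suc i) ys)" if "i < k" for i
    using Suc.prems(3)[of "Suc i"] that xs by simp
  ultimately have "ys \<in> walks F v k" using Suc.IH by blast
  moreover have "x \<in> F ys" using Suc.prems(3)[of 0] xs by simp
  ultimately show ?case using xs by force
qed

section \<open>Irredundant step sequences and rational edges\<close>

abbreviation step :: "complex list \<Rightarrow> nat \<Rightarrow> complex" where
  "step xs i \<equiv> xs ! i - xs ! Suc i"

definition irredundant :: "complex list \<Rightarrow> bool" where
  "irredundant xs \<longleftrightarrow> (\<forall>J\<subseteq>{..<length xs - 1}. J \<noteq> {} \<longrightarrow> (\<Sum>i\<in>J. step xs i) \<noteq> 0)"

text \<open>A new vanishing subfamily must use the new step, which has index 0. It then determines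
  \<open>x\<close> from a subset of the old steps, so \<open>x\<close> only has to avoid one point
  per subset.\<close>

lemma irredundant_Cons:
  assumes "xs \<noteq> []" "irredundant xs"
    and "x \<notin> (\<lambda>J. hd xs - (\<Sum>i\<in>J. step xs i)) ` Pow {..<length xs - 1}"
  shows "irredundant (x # xs)"
  unfolding irredundant_def
proof (intro allI impI)
  fix J assume J: "J \<subseteq> {..<length (x # xs) - 1}" "J \<noteq> {}"
  define K where "K = {i. Suc i \<in> J}"
  have K: "K \<subseteq> {..<length xs - 1}" using J by (auto simp: K_def)
  have finK: "finite K" using K finite_subset by blast
  have sK: "(\<Sum>i\<in>Suc ` K. step (x # xs) i) = (\<Sum>i\<in>K. step xs i)"
    by (simp add: sum.reindex)
  show "(\<Sum>i\<in>J. step (x # xs) i) \<noteq> 0"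
  proof (cases "0 \<in> J")
    case True
    have "i \<in> J \<longleftrightarrow> i \<in> insert 0 (Suc ` K)" for i
      using True by (cases i) (auto simp: K_def)
    then have "J = insert 0 (Suc ` K)" by blast
    then have "(\<Sum>i\<in>J. step (x # xs) i) = x - hd xs + (\<Sum>i\<in>K. step xs i)"
      using finK sK assms(1) by (simp add: hd_conv_nth)
    moreover have "x \<noteq> hd xs - (\<Sum>i\<in>K. step xs i)" using assms(3) K by blast
    ultimately show ?thesis by algebra
  next
    case False
    have "i \<in> J \<longleftrightarrow> i \<in> Suc ` K" for i
      using False by (cases i) (auto simp: K_def)
    then have JK: "J = Suc ` K" by blast
    then have "K \<noteq> {}" using J(2) by blast
    then have "(\<Sum>i\<in>K. step xs i) \<noteq> 0"
      using assms(2) K unfolding irredundant_def by blast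
    then show ?thesis unfolding JK sK .
  qed
qed

text \<open>The rational angle is recorded as a unit direction that is a root of unity, the form in
  which Mann's theorem applies.\<close>

definition rational_edge :: "complex \<Rightarrow> complex \<Rightarrow> bool" where
  "rational_edge p q \<longleftrightarrow> p \<noteq> q \<and> cmod (p - q) \<in> \<rat> \<and> (\<exists>N>0. sgn (q - p) ^ N = 1)"

lemma rational_edge_sym: "symp rational_edge"
proof (rule sympI)
  fix p q assume pq: "rational_edge p q"
  then obtain N where N: "N > 0" "sgn (q - p) ^ N = 1" by (auto simp: rational_edge_def)
  \<comment> \<open>Reversal negates the direction; the doubled exponent absorbs the sign.\<close>
  have "sgn (p - q) ^ (2 * N) = (- sgn (q - p)) ^ (2 * N)"
    by (metis minus_diff_eq sgn_minus)
  also have "\<dots> = (sgn (q - p) ^ N) ^ 2" by (simp add: mult.commute flip: power_mult)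
  finally have "sgn (p - q) ^ (2 * N) = 1" using N by simp
  moreover have "2 * N > 0" using N by simp
  ultimately have "\<exists>N>0. sgn (p - q) ^ N = 1" by blast
  then show "rational_edge q p" using pq by (auto simp: rational_edge_def norm_minus_commute)
qed

lemma rational_angle_imp_root_of_unity:
  assumes "rational_angle p q"
  shows "\<exists>N>0. sgn (q - p) ^ N = 1"
proof -
  obtain r \<gamma> :: real where r: "r > 0" "\<gamma> \<in> \<rat>" "q - p = of_real r * exp (\<i> * of_real (pi * \<gamma>))"
    using assms by (auto simp: rational_angle_def)
  obtain a b :: int where ab: "b > 0" "\<gamma> = a / b" using r(2) by (elim Rats_cases') auto
  have "q - p = of_real r * cis (pi * \<gamma>)" using r(3) by (simp add: cis_conv_exp)
  then have "sgn (q - p) = cis (pi * \<gamma>)" using r(1) by (simp add: sgn_mult sgn_of_real)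
  then have "sgn (q - p) ^ (2 * nat b) = cis (2 * pi * of_int a)"
    using ab by (simp add: Complex.DeMoivre mult_ac)
  also have "\<dots> = 1" using cis_multiple_2pi[of "of_int a"] by simp
  finally show ?thesis using ab(1) by (intro exI[of _ "2 * nat b"]) auto
qed

text \<open>The left side bounds from below the irredundant walks of length \<open>k\<close> from
  \<open>v\<close>. The right side bounds them from above, summing over the end point.\<close>

lemma rational_edge_walk_count:
  fixes S T :: "complex set" and m c :: real
  assumes fin: "finite S" and T: "T \<subseteq> S" and v: "v \<in> T"
    and lines: "\<And>a b. b \<noteq> 0 \<Longrightarrow> real (card (S \<inter> plane_line a b)) \<le> m"
    and deg: "\<And>v. v \<in> T \<Longrightarrow> c \<le> card {q \<in> T. q \<noteq> v \<and> rational_edge v q}"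
    and c: "c \<ge> 2 ^ k"
  shows "(c - 2 ^ k) ^ k \<le> card S * (k * primorial (2 * k) * m) ^ k"
proof -
  define F where "F xs = {x \<in> T. rational_edge (hd xs) x \<and> irredundant (x # xs)}" for xs
  have finT: "finite T" using fin T finite_subset by blast
  have finF: "finite (F xs)" for xs using finT by (simp add: F_def)
  have walk: "length xs = Suc j \<and> set xs \<subseteq> T \<and> last xs = v \<and> irredundant xs \<and>
      (\<forall>i<j. rational_edge (xs ! Suc i) (xs ! i))" if "xs \<in> walks F v j" for xs j
    using that
  proof (induction j arbitrary: xs)
    case 0
    then show ?case using v by (simp add: irredundant_def)
  next
    case (Suc j)
    then obtain x ys where xs: "xs = x # ys" "ys \<in> walks F v j" "x \<in> F ys" by auto
    have IH: "length ys = Suc j" "set ys \<subseteq> T" "last ys = v"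
      "\<forall>i<j. rational_edge (ys ! Suc i) (ys ! i)" using Suc.IH[OF xs(2)] by auto
    have "rational_edge (xs ! Suc i) (xs ! i)" if "i < Suc j" for i
    proof (cases i)
      case 0
      have "ys \<noteq> []" using IH by auto
      then show ?thesis using 0 xs by (simp add: F_def hd_conv_nth)
    next
      case (Suc i')
      then show ?thesis using IH that xs by simp
    qed
    then show ?case using xs IH by (auto simp: F_def)
  qed
  have ge: "(c - 2 ^ k) ^ k \<le> real (card (walks F v k))"
  proof (rule card_walks_ge[OF finF])
    fix j xs assume j: "j < k" and xs: "xs \<in> walks F v j"
    note w = walk[OF xs]
    have ne: "xs \<noteq> []" using w by auto
    define D where "D = {q \<in> T. q \<noteq> hd xs \<and> rational_edge (hd xs) q}"
    \<comment> \<open>The next vertices that would create a vanishing subfamily: one for each subset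
      of the \<open>j\<close> steps made so far.\<close>
    define B where "B = (\<lambda>J. hd xs - (\<Sum>i\<in>J. step xs i)) ` Pow {..<length xs - 1}"
    have "card B \<le> card (Pow {..<length xs - 1})" unfolding B_def by (intro card_image_le) simp
    also have "\<dots> = 2 ^ j" using w by (simp add: card_Pow)
    also have "\<dots> \<le> 2 ^ k" using j by (intro power_increasing) auto
    finally have B: "card B \<le> 2 ^ k" .
    have "D - B \<subseteq> F xs"
      using irredundant_Cons[OF ne] w by (auto simp: D_def F_def B_def)
    then have "card (D - B) \<le> card (F xs)" using finF by (intro card_mono)
    moreover have "card D - card B \<le> card (D - B)"
      by (rule diff_card_le_card_Diff) (simp add: B_def)
    ultimately have "card D \<le> card (F xs) + card B" by linarith
    then have "card D \<le> card (F xs) + 2 ^ k" using B by linarith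
    then have "real (card D) \<le> real (card (F xs)) + 2 ^ k"
      by (metis of_nat_add of_nat_le_iff of_nat_numeral of_nat_power)
    moreover have "c \<le> card D" unfolding D_def using w ne by (intro deg) auto
    ultimately show "c - 2 ^ k \<le> card (F xs)" by linarith
  qed (use c in simp)
  have m: "m \<ge> 0"
  proof -
    have "card (S \<inter> plane_line 0 1) \<le> m" using lines by simp
    then show ?thesis by linarith
  qed
  define M where "M = (k * primorial (2 * k) * m) ^ k"
  have fiber: "card {xs \<in> walks F v k. hd xs = w} \<le> M" for w
  proof (cases "{xs \<in> walks F v k. hd xs = w} = {}")
    case True
    show ?thesis unfolding True M_def using m by simp
  next
    case False
    then obtain ys where ys: "ys \<in> walks F v k" "hd ys = w" by blast
    define U where "U = {u::complex. u ^ primorial (2 * k) = 1}"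
    \<comment> \<open>By comparison with the reference walk \<open>ys\<close>, every walk ending at
      \<open>w\<close> will be shown to take all its directions from \<open>H\<close>.\<close>
    define H where "H = (\<lambda>(j, u). sgn (step ys j) * u) ` ({..<k} \<times> U)"
    have finU: "finite U" unfolding U_def using primorial_pos by (intro finite_roots_unity) (simp add: Suc_leI)
    have finH: "finite H" using finU by (simp add: H_def)
    have "card H \<le> card ({..<k} \<times> U)" unfolding H_def using finU by (intro card_image_le) auto
    also have "\<dots> \<le> k * primorial (2 * k)"
      using card_roots_unity[of "primorial (2 * k)", where 'a = complex] primorial_pos[of "2 * k"]
      by (simp add: card_cartesian_product U_def)
    finally have cH: "card H \<le> k * primorial (2 * k)" .
    have telescope: "(\<Sum>i<k. step xs i) = w - v" if "xs \<in> walks F v k" "hd xs = w" for xs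
    proof -
      note wk = walk[OF that(1)]
      then have "xs \<noteq> []" by auto
      then have "xs ! 0 = w" "xs ! k = v" using wk that(2) by (auto simp: hd_conv_nth last_conv_nth)
      then show ?thesis by (simp add: sum_lessThan_telescope')
    qed
    have rat: "cmod (step xs i) \<in> \<rat> \<and> (\<exists>N>0. sgn (step xs i) ^ N = 1) \<and> step xs i \<noteq> 0"
      if "xs \<in> walks F v k" "i < k" for xs i
      using walk[OF that(1)] that(2) by (auto simp: rational_edge_def norm_minus_commute)
    have polar: "complex_of_real (cmod x) * sgn x = x" for x
      by (cases "x = 0") (simp_all add: sgn_eq)
    \<comment> \<open>The rule \<open>G\<close> forgets irredundancy and edges and keeps only the
      allowed directions, so its continuations lie on \<open>card H\<close> lines.\<close>
    define G where "G xs = {x \<in> S. x \<noteq> hd xs \<and> sgn (x - hd xs) \<in> H}" for xs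
    have finG: "finite (G xs)" for xs using fin by (simp add: G_def)
    have "{xs \<in> walks F v k. hd xs = w} \<subseteq> walks G v k"
    proof safe
      fix xs assume xs: "xs \<in> walks F v k" "w = hd xs"
      note wk = walk[OF xs(1)]
      show "xs \<in> walks G v k"
      proof (rule walksI)
        fix i assume i: "i < k"
        \<comment> \<open>Each step is its rational length times its unit direction, and both walks
          sum to \<open>w - v\<close>; the two representations have \<open>k\<close> terms each,
          whence \<open>2 * k\<close>.\<close>
        have "\<exists>j\<in>{..<k}. (sgn (step xs i) / sgn (step ys j)) ^ primorial (card {..<k} + card {..<k}) = 1"
        proof (rule two_representations[where a = "\<lambda>i. cmod (step xs i)"
              and b = "\<lambda>i. cmod (step ys i)" and z = "\<lambda>i. sgn (step xs i)"])
          show "(\<Sum>i<k. of_real (cmod (step xs i)) * sgn (step xs i)) =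
              (\<Sum>i<k. of_real (cmod (step ys i)) * sgn (step ys i))"
            unfolding polar using telescope[OF xs(1) xs(2)[symmetric]] telescope[OF ys] by simp
          show "(\<Sum>i\<in>J. of_real (cmod (step xs i)) * sgn (step xs i)) \<noteq> 0"
            if "J \<subseteq> {..<k}" "J \<noteq> {}" for J
            unfolding polar using wk that by (simp add: irredundant_def)
          show "cmod (step xs i) \<in> \<rat> \<and> (\<exists>N>0. sgn (step xs i) ^ N = 1)" if "i \<in> {..<k}" for i
            using rat[OF xs(1), of i] that by blast
          show "cmod (step ys i) \<in> \<rat> \<and> (\<exists>N>0. sgn (step ys i) ^ N = 1)" if "i \<in> {..<k}" for i
            using rat[OF ys(1), of i] that by blast
        qed (use i in auto)
        then obtain j where j: "j < k" "sgn (step xs i) / sgn (step ys j) \<in> U"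
          by (auto simp: U_def mult_2)
        have "sgn (step xs i) = sgn (step ys j) * (sgn (step xs i) / sgn (step ys j))"
          using rat[OF ys(1) j(1)] by (simp add: sgn_zero_iff)
        also have "\<dots> \<in> H"
          unfolding H_def using j by (intro image_eqI[of _ _ "(j, _)"]) auto
        finally have "sgn (step xs i) \<in> H" .
        moreover have "hd (drop (Suc i) xs) = xs ! Suc i" using wk i by (simp add: hd_drop_conv_nth)
        moreover have "xs ! i \<in> S"
        proof -
          have "xs ! i \<in> set xs" using wk i by (intro nth_mem) simp
          then show ?thesis using wk T by blast
        qed
        ultimately show "xs ! i \<in> G (drop (Suc i) xs)" using rat[OF xs(1) i] by (simp add: G_def)
      qed (use wk in auto)
    qed
    then have "card {xs \<in> walks F v k. hd xs = w} \<le> card (walks G v k)"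
      using finG by (intro card_mono finite_walks)
    also have "real \<dots> \<le> M" unfolding M_def
    proof (rule card_walks_le[OF finG])
      fix xs
      \<comment> \<open>A zero direction would give a degenerate line, to which \<open>lines\<close>
        does not apply.\<close>
      have nz: "h \<noteq> 0" if "h \<in> H" for h
      proof -
        obtain j u where ju: "j < k" "u \<in> U" "h = sgn (step ys j) * u"
          using \<open>h \<in> H\<close> by (auto simp: H_def)
        then have "step ys j \<noteq> 0" using rat[OF ys(1)] by blast
        moreover have "u \<noteq> 0"
          using ju(2) primorial_pos[of "2 * k"] by (auto simp: U_def power_0_left)
        ultimately show ?thesis using ju(3) by (simp add: sgn_zero_iff)
      qed
      have "G xs \<subseteq> (\<Union>h\<in>H. S \<inter> plane_line (hd xs) h)"
      proof
        fix x assume x: "x \<in> G xs"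
        have "x = hd xs + of_real (cmod (x - hd xs)) * sgn (x - hd xs)" using polar[of "x - hd xs"] by simp
        then have "x \<in> plane_line (hd xs) (sgn (x - hd xs))" unfolding plane_line_def by blast
        then show "x \<in> (\<Union>h\<in>H. S \<inter> plane_line (hd xs) h)" using x by (auto simp: G_def)
      qed
      then have "card (G xs) \<le> card (\<Union>h\<in>H. S \<inter> plane_line (hd xs) h)"
        using fin finH by (intro card_mono) auto
      also have "\<dots> \<le> (\<Sum>h\<in>H. card (S \<inter> plane_line (hd xs) h))" using finH by (rule card_UN_le)
      also have "real \<dots> \<le> card H * m" unfolding of_nat_sum
        using nz lines by (intro sum_bounded_above) auto
      also have "\<dots> \<le> real (k * primorial (2 * k)) * m"
        using cH m by (intro mult_right_mono) (simp_all only: of_nat_le_iff)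
      finally show "real (card (G xs)) \<le> k * primorial (2 * k) * m" by simp
    qed
    finally show ?thesis by simp
  qed
  have "walks F v k = (\<Union>w\<in>S. {xs \<in> walks F v k. hd xs = w})"
  proof -
    have "hd xs \<in> S" if "xs \<in> walks F v k" for xs
    proof -
      have "xs \<noteq> []" using walk[OF that] by auto
      then have "hd xs \<in> set xs" by (rule hd_in_set)
      then show ?thesis using walk[OF that] T by blast
    qed
    then show ?thesis by blast
  qed
  then have "card (walks F v k) = card (\<Union>w\<in>S. {xs \<in> walks F v k. hd xs = w})"
    by (rule arg_cong)
  also have "\<dots> \<le> (\<Sum>w\<in>S. card {xs \<in> walks F v k. hd xs = w})"
    using fin by (rule card_UN_le)
  also have "real \<dots> \<le> card S * M" unfolding of_nat_sum
    using fiber by (intro sum_bounded_above)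
  finally show ?thesis using ge by (simp add: M_def)
qed

subsection \<open>The bound\<close>

lemma walk_bound_contradiction:
  fixes L m c n :: real
  assumes L: "L > 6" and n: "n = exp (L\<^sup>2)" and m: "m \<ge> 1" and k: "L / 2 \<le> real k" "real k \<le> L / 2 + 1"
    and c: "c = m * exp (6 * L)"
  shows "c \<ge> 2 ^ k" "n * (real (k * primorial (2 * k)) * m) ^ k < (c - 2 ^ k) ^ k"
proof -
  \<comment> \<open>\<open>Q ^ k\<close> dominates the upper bound: since \<open>k\<close> is at
    least \<open>L / 2\<close>, the factor \<open>exp (2 * L) ^ k\<close> absorbs \<open>n\<close>.
    The exponents in \<open>Q\<close> add up to at most \<open>2 * L + L / 2 + 4 * k\<close>, which
    is below \<open>6 * L - 1\<close>.\<close>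
  define Q where "Q = exp (2 * L) * (k * 4 ^ (2 * k) * m)"
  have e2: "(2::real) \<le> exp 1" using exp_ge_add_one_self[of 1] by simp
  have two: "(2::real) ^ k \<le> exp k"
    using power_mono[OF e2, of k] by (simp flip: exp_of_nat_mult)
  have "(4::real) ^ (2 * k) = (2 ^ 2) ^ (2 * k)" by simp
  also have "\<dots> = (2 ^ k) ^ 4" by (simp only: power_mult[symmetric]) (simp add: mult.commute)
  also have "\<dots> \<le> exp k ^ 4" using two by (intro power_mono) auto
  finally have sixteen: "(4::real) ^ (2 * k) \<le> exp (4 * k)" by (simp flip: exp_of_nat_mult)
  have "real k \<le> exp (L / 2)" using k(2) exp_ge_add_one_self[of "L / 2"] by linarith
  then have "real k * 4 ^ (2 * k) \<le> exp (L / 2) * exp (4 * k)"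
    using sixteen by (intro mult_mono) auto
  then have "Q \<le> exp (2 * L) * (exp (L / 2) * exp (4 * k) * m)"
    unfolding Q_def using m by (intro mult_left_mono mult_right_mono) auto
  also have "\<dots> = exp (2 * L + L / 2 + 4 * k) * m"
    by (simp only: exp_add mult.assoc)
  also have "\<dots> \<le> exp (6 * L - 1) * m"
    using k L m by (intro mult_right_mono) auto
  finally have Q: "Q \<le> exp (6 * L - 1) * m" .
  have "(2::real) ^ k < exp (6 * L - 1)"
    using two k L by (elim le_less_trans) auto
  also have "\<dots> \<le> exp (6 * L - 1) * m" using m by simp
  \<comment> \<open>Both terms are bounded by \<open>exp (6 * L - 1) * m\<close>, and the spare
    factor \<open>exp 1\<close>, at least 2, pays for their sum.\<close>
  finally have "Q + 2 ^ k < 2 * (exp (6 * L - 1) * m)" using Q by linarith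
  also have "\<dots> \<le> exp 1 * (exp (6 * L - 1) * m)"
    using e2 m by (intro mult_right_mono) auto
  also have "\<dots> = c" unfolding c by (simp flip: exp_add mult.assoc)
  finally have Qc: "Q + 2 ^ k < c" .
  have Q0: "Q \<ge> 0" using m by (simp add: Q_def)
  then show "c \<ge> 2 ^ k" using Qc by linarith
  have "n \<le> exp (2 * L) ^ k"
  proof -
    have "L * L \<le> real k * 2 * L" using k(1) L by (intro mult_right_mono) auto
    then have "L\<^sup>2 \<le> real k * (2 * L)" by (simp add: power2_eq_square mult.assoc)
    then show ?thesis unfolding n exp_of_nat_mult[symmetric] by simp
  qed
  moreover have "(real (k * primorial (2 * k)) * m) ^ k \<le> (k * 4 ^ (2 * k) * m) ^ k"
  proof -
    have "real (primorial (2 * k)) \<le> 4 ^ (2 * k)"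
      using primorial_le[of "2 * k"] by (metis of_nat_le_iff of_nat_numeral of_nat_power)
    then show ?thesis using m by (intro power_mono mult_right_mono) (auto intro: mult_left_mono)
  qed
  ultimately have "n * (real (k * primorial (2 * k)) * m) ^ k \<le> Q ^ k"
    unfolding Q_def power_mult_distrib[of "exp (2 * L)"] using m by (intro mult_mono) auto
  also have "\<dots> < (c - 2 ^ k) ^ k"
    using Qc Q0 k(1) L by (intro power_strict_mono) auto
  finally show "n * (real (k * primorial (2 * k)) * m) ^ k < (c - 2 ^ k) ^ k" .
qed

theorem theorem3:
  fixes S :: "complex set" and n :: nat and \<alpha> :: real
  assumes "0 < \<alpha>" and "\<alpha> < 1/2"
    and "n \<ge> 2" and "finite S" and "card S = n"
    and "\<forall>a b. b \<noteq> 0 \<longrightarrow> real (card (S \<inter> plane_line a b)) \<le> real n powr \<alpha>"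
  shows "real (card {{p, q} | p q. p \<in> S \<and> q \<in> S \<and> p \<noteq> q \<and>
              cmod (p - q) \<in> \<rat> \<and> rational_angle p q})
         \<le> real n powr (1 + \<alpha> + 6 / sqrt (ln (real n)))"
proof -
  define L where "L = sqrt (ln n)"
  define m where "m = real n powr \<alpha>"
  define E where "E = {{p, q} | p q. p \<in> S \<and> q \<in> S \<and> p \<noteq> q \<and>
              cmod (p - q) \<in> \<rat> \<and> rational_angle p q}"
  have L0: "L > 0" using assms(3) by (simp add: L_def)
  have n: "real n = exp (L\<^sup>2)" using assms(3) by (simp add: L_def)
  have "E \<subseteq> edges rational_edge S"
    using rational_angle_imp_root_of_unity by (fastforce simp: E_def edges_def rational_edge_def)
  then have E: "card E \<le> card (edges rational_edge S)"
    using assms(4) by (intro card_mono finite_edges)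
  have "real (card E) \<le> real n powr (1 + \<alpha> + 6 / L)"
  \<comment> \<open>For \<open>L\<close> at most 6 the exponent is at least 2 and the trivial bound
    \<open>n ^ 2\<close> suffices.\<close>
  proof (cases "L \<le> 6")
    case True
    have "E \<subseteq> (\<lambda>(p, q). {p, q}) ` (S \<times> S)" by (force simp: E_def)
    then have "card E \<le> card ((\<lambda>(p, q). {p, q}) ` (S \<times> S))"
      using assms(4) by (intro card_mono) auto
    also have "\<dots> \<le> card (S \<times> S)" using assms(4) by (intro card_image_le) auto
    finally have "card E \<le> n ^ 2"
      using assms(5) by (simp add: card_cartesian_product power2_eq_square)
    then have "real (card E) \<le> real n ^ 2" by (metis of_nat_le_iff of_nat_power)
    also have "\<dots> = real n powr 2" using assms(3) by simp
    also have "\<dots> \<le> real n powr (1 + \<alpha> + 6 / L)"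
    proof (rule powr_mono)
      have "6 / L \<ge> 1" using True L0 by simp
      then show "2 \<le> 1 + \<alpha> + 6 / L" using assms(1) by linarith
    qed (use assms(3) in simp)
    finally show ?thesis .
  next
    case False
    show ?thesis
    proof (rule ccontr)
      define c where "c = m * exp (6 * L)"
      define k where "k = nat \<lceil>L / 2\<rceil>"
      have k: "L / 2 \<le> real k" "real k \<le> L / 2 + 1" using L0 unfolding k_def by linarith+
      have m: "m \<ge> 1" using assms(1,3) by (simp add: m_def ge_one_powr_ge_zero)
      \<comment> \<open>As \<open>n = exp (L\<^sup>2)\<close>, the claimed bound is exactly
        \<open>c * card S\<close>, the threshold for a subgraph of minimum degree above
        \<open>c\<close>.\<close>
      have "real n powr (1 + \<alpha> + 6 / L) = real n * m * real n powr (6 / L)"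
        using assms(3) by (simp add: powr_add m_def)
      also have "real n powr (6 / L) = exp (6 * L)"
        using L0 unfolding n by (simp add: powr_def power2_eq_square)
      finally have "real n powr (1 + \<alpha> + 6 / L) = c * card S"
        using assms(5) by (simp add: c_def)
      moreover assume "\<not> ?thesis"
      ultimately have "c * card S < card (edges rational_edge S)" using E by linarith
      moreover have "c \<ge> 0" using m by (simp add: c_def)
      ultimately obtain T where T: "T \<subseteq> S" "T \<noteq> {}"
        "\<forall>v\<in>T. c < card {q \<in> T. q \<noteq> v \<and> rational_edge v q}"
        using min_degree_subset[OF assms(4) _ rational_edge_sym] by blast
      then obtain v where "v \<in> T" by blast
      have "L > 6" using False by simp
      note bound = walk_bound_contradiction[OF this n m k c_def]
      have "(c - 2 ^ k) ^ k \<le> card S * (k * primorial (2 * k) * m) ^ k"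
      proof (rule rational_edge_walk_count[OF assms(4) T(1) \<open>v \<in> T\<close> _ _ bound(1)])
        show "real (card (S \<inter> plane_line a b)) \<le> m" if "b \<noteq> 0" for a b
          using assms(6) that by (simp add: m_def)
        show "c \<le> card {q \<in> T. q \<noteq> v \<and> rational_edge v q}" if "v \<in> T" for v
          using T(3) that by (intro less_imp_le) blast
      qed
      then show False using bound(2) assms(5) by simp
    qed
  qed
  then show ?thesis by (simp add: E_def L_def)
qed

end
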